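(* Let $(U^j)_{j\ge 0}$ be a positive solution (all entries $u_i^j>0$) of the implicit scheme. If there exists $j_0$ such that $\Phi_{h}(U^{j_0})<0$, then $(U^j)_{j\ge0}$ blows up.
   Context: Let $N\ge 1$ be an integer and $p>1$ a real number. $M=\mathrm{diag}(m_1,\dots,m_N)$ is a diagonal matrix with $m_k>0$ for all $k$. $A=(a_{ik})$ is a real symmetric positive semidefinite $N\times N$ matrix with $a_{ik}\le 0$ for $i\neq k$, $a_{ii}>0$, and $\sum_{k=1}^N a_{ik}\ge 0$ for every $i$. All operations between vectors of $\mathbb{R}^N$ (in particular powers) are understood coordinate by coordinate, and $\langle\cdot,\cdot\rangle$ is the Euclidean inner product. Implicit scheme: fix $\lambda>0$ and an initial vector $U^0\in\mathbb{R}^N$. For $j\ge 0$ write $U^j=(u_1^j,\dots,u_N^j)$, $w^j=\sum_{k=1}^N m_k u_k^j$, $\tau_j=\lambda/(w^j)^p$, and $$M U^{j+1}= M U^j + \tau_j \left (- AU^{j+1} + M (U^j)^p\right ).$$ The discrete energy is $$\Phi_h(U)=\frac12\langle AU,U\rangle-\frac{1}{p+1}\langle MU^{p+1},E\rangle,\qquad E=(1,1,\dots,1).$$ A solution blows up if $\lim_{j\to\infty}\|U^j\|_\infty=\infty$ and $\sum_{j=0}^\infty \tau_j<\infty$. *)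

theory Defs
  imports "HOL-Analysis.Analysis"
begin

definition diag_mat :: "real ^ 'n \<Rightarrow> real ^ 'n ^ 'n" where
  "diag_mat m = (\<chi> i k. if i = k then m $ i else 0)"

definition psd :: "real ^ 'n ^ 'n \<Rightarrow> bool" where
  "psd A \<longleftrightarrow> (\<forall>x. 0 \<le> (A *v x) \<bullet> x)"

(* "powr" agrees with the usual real power only at nonnegative entries;
   it is applied below to positive vectors only. *)
definition vec_powr :: "real ^ 'n \<Rightarrow> real \<Rightarrow> real ^ 'n" where
  "vec_powr x q = (\<chi> i. (x $ i) powr q)"

definition mass :: "real ^ 'n \<Rightarrow> real ^ 'n \<Rightarrow> real" where
  "mass m x = (\<Sum>k\<in>UNIV. m $ k * x $ k)"

definition time_step ::
  "real ^ 'n \<Rightarrow> real \<Rightarrow> real \<Rightarrow> (nat \<Rightarrow> real ^ 'n) \<Rightarrow> nat \<Rightarrow> real" where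
  "time_step m p lam U j = lam / mass m (U j) powr p"

definition implicit_scheme ::
  "real ^ 'n ^ 'n \<Rightarrow> real ^ 'n \<Rightarrow> real \<Rightarrow> real \<Rightarrow> (nat \<Rightarrow> real ^ 'n) \<Rightarrow> bool" where
  "implicit_scheme A m p lam U \<longleftrightarrow>
     (\<forall>j. diag_mat m *v U (Suc j) =
          diag_mat m *v U j +
          time_step m p lam U j *\<^sub>R
            (- (A *v U (Suc j)) + diag_mat m *v vec_powr (U j) p))"

definition energy :: "real ^ 'n ^ 'n \<Rightarrow> real ^ 'n \<Rightarrow> real \<Rightarrow> real ^ 'n \<Rightarrow> real" where
  "energy A m p x =
     1 / 2 * ((A *v x) \<bullet> x)
     - 1 / (p + 1) * ((diag_mat m *v vec_powr x (p + 1)) \<bullet> (\<chi> i. 1))"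

(* On "real ^ 'n", "infnorm" is the maximum of the absolute values of the entries. *)
definition blows_up ::
  "real ^ 'n \<Rightarrow> real \<Rightarrow> real \<Rightarrow> (nat \<Rightarrow> real ^ 'n) \<Rightarrow> bool" where
  "blows_up m p lam U \<longleftrightarrow>
     filterlim (\<lambda>j. infnorm (U j)) at_top sequentially \<and>
     summable (time_step m p lam U)"

end

theory Submission
  imports Defs
begin

text \<open>
  The proof combines the decay of the energy with a growth law for the second moment.
  For a positive vector \<open>x\<close> write \<open>w\<close> for its mass and
  \<open>y\<close>, \<open>S\<close>, \<open>Q\<close> for its moments of order \<open>2\<close>, \<open>p + 1\<close>, \<open>2 p\<close>;
  let \<open>D\<close> be the mass-weighted squared length of the increment \<open>d\<close> of one step and
  \<open>\<Phi>\<close> the energy.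

  Testing the scheme with \<open>d\<close> gives \<open>\<Phi>' \<le> \<Phi> - D / \<tau>\<close> (lemma \<open>energy_decay\<close>): the diffusion is
  implicit and convex, and the source is explicit and enters the energy through a concave term, so
  both discretization errors have the good sign. Testing with \<open>x\<close> as well and eliminating the
  cross terms gives \<open>y' - y \<ge> 3 D + \<tau> (2 (p - 1) / (p + 1) S - 4 \<Phi>) - 2 \<tau> \<langle>M x^p, d\<rangle>\<close>. Only the last
  term is bad, and Young's inequality with a free parameter \<open>s\<close> bounds it by
  \<open>D / s + s \<tau>\<^sup>2 Q\<close> (lemma \<open>second_moment_growth\<close>).

  The time step \<open>\<lambda> / w^p\<close> is exactly what makes these terms comparable. All entries are at most a
  constant times \<open>w\<close>, and one is at least a constant times \<open>w\<close>; hence \<open>\<tau>\<^sup>2 Q\<close> is bounded by a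
  constant \<open>K\<close>, while \<open>\<tau> S\<close> is at least a constant times \<open>w\<close>. Once \<open>\<Phi> \<le> - c < 0\<close>, two choices
  of \<open>s\<close> finish the proof.

  With \<open>s\<close> proportional to \<open>\<tau>\<close>, the term \<open>D / s\<close> is a multiple of \<open>D / \<tau>\<close>, which the energy decay
  pays for. So \<open>y - G \<Phi>\<close>, for a suitable constant \<open>G\<close>, increases by at least
  \<open>2 c \<tau> + C w\<close>. This is bounded away from zero, since \<open>\<tau>\<close> is large when \<open>w\<close> is small. Hence
  \<open>y - G \<Phi>\<close> diverges, and as it is bounded by a function of \<open>w\<close>, so does \<open>w\<close>, and with it the
  maximum norm.

  This functional is too coarse for the summability of \<open>\<tau>\<close>, because it grows like \<open>w^(p + 1)\<close>
  and would only yield \<open>w \<ge> e j^(1 / p)\<close>, that is, a harmonic bound on \<open>\<tau>\<close>. With \<open>s = 1\<close> one gets instead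
  \<open>y' - y \<ge> C w - K\<close>. For large \<open>w\<close> this is at least a multiple of \<open>sqrt y\<close>, because \<open>sqrt y\<close> and
  \<open>w\<close> are comparable. So \<open>sqrt y\<close>, and therefore \<open>w\<close>, grows at least linearly in \<open>j\<close>
  (lemma \<open>sqrt_linear_growth\<close>), and \<open>\<tau>\<close> is dominated by a multiple of \<open>j^(- p)\<close>, which is summable
  as \<open>p > 1\<close>.
\<close>

section \<open>Weighted moments of a positive vector\<close>

definition moment :: "real ^ 'n \<Rightarrow> real \<Rightarrow> real ^ 'n \<Rightarrow> real" where
  "moment m q x = (\<Sum>k\<in>UNIV. m $ k * (x $ k) powr q)"

text \<open>
  Each summand of the mass is at most the mass, so no entry exceeds \<open>mass m x / \<mu>\<close>.
\<close>

lemma moment_le_mass_powr: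
  fixes m x :: "real ^ 'n"
  assumes \<mu>: "\<mu> > 0" "\<And>k. \<mu> \<le> m $ k" and x: "\<And>k. x $ k > 0" and q: "q \<ge> 0"
  shows "moment m q x \<le> (\<Sum>k\<in>UNIV. m $ k) * (mass m x / \<mu>) powr q"
proof -
  have m: "m $ k > 0" for k
    using \<mu> by (meson less_le_trans)
  have "x $ k \<le> mass m x / \<mu>" for k
  proof -
    have "\<mu> * x $ k \<le> m $ k * x $ k"
      using \<mu> x[of k] by (intro mult_right_mono) (auto intro: less_imp_le)
    also have "\<dots> \<le> mass m x"
      unfolding mass_def using m x
      by (intro member_le_sum[of k UNIV "\<lambda>k. m $ k * x $ k"]) (auto intro!: less_imp_le)
    finally show ?thesis
      using \<mu>(1) by (simp add: field_simps)
  qed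
  then have "m $ k * x $ k powr q \<le> m $ k * (mass m x / \<mu>) powr q" for k
    using m[of k] x[of k] q by (intro mult_left_mono powr_mono2) (auto intro: less_imp_le)
  then show ?thesis
    unfolding moment_def sum_distrib_right by (intro sum_mono) auto
qed

text \<open>
  Some entry is at least the weighted average \<open>mass m x / (\<Sum>k\<in>UNIV. m $ k)\<close>; its summand alone
  gives the bound.
\<close>

lemma mass_powr_le_moment:
  fixes m x :: "real ^ 'n"
  assumes \<mu>: "\<mu> > 0" "\<And>k. \<mu> \<le> m $ k" and x: "\<And>k. x $ k > 0" and q: "q \<ge> 0"
  shows "\<mu> * (mass m x / (\<Sum>k\<in>UNIV. m $ k)) powr q \<le> moment m q x"
proof -
  have m: "m $ k > 0" for k
    using \<mu> by (meson less_le_trans)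
  let ?W = "\<Sum>k\<in>UNIV. m $ k"
  have W: "?W > 0"
    using m by (intro sum_pos) auto
  have w: "mass m x > 0"
    unfolding mass_def using m x by (intro sum_pos) auto
  have "\<exists>i. mass m x / ?W \<le> x $ i"
  proof (rule ccontr)
    assume "\<not> ?thesis"
    then have "x $ k < mass m x / ?W" for k
      by (simp add: not_le)
    then have "mass m x < (\<Sum>k\<in>UNIV. m $ k * (mass m x / ?W))"
      unfolding mass_def[of m x]
      using m by (intro sum_strict_mono mult_strict_left_mono) (auto simp: mass_def)
    also have "\<dots> = mass m x"
      using W by (simp flip: sum_distrib_right sum_divide_distrib)
    finally show False by simp
  qed
  then obtain i where i: "mass m x / ?W \<le> x $ i" ..
  have "\<mu> * (mass m x / ?W) powr q \<le> m $ i * x $ i powr q"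
    using \<mu> m[of i] i q w W
    by (intro mult_mono powr_mono2) (auto intro!: less_imp_le)
  also have "\<dots> \<le> moment m q x"
    unfolding moment_def using m
    by (intro member_le_sum[of i UNIV "\<lambda>k. m $ k * x $ k powr q"]) (auto intro!: mult_nonneg_nonneg simp: less_imp_le)
  finally show ?thesis .
qed

section \<open>The two estimates for a single step\<close>

lemma diag_mat_mult_nth: "(diag_mat m *v x) $ i = m $ i * x $ i"
proof -
  have "(diag_mat m *v x) $ i = (\<Sum>k\<in>UNIV. if i = k then m $ i * x $ k else 0)"
    by (auto simp: diag_mat_def matrix_vector_mult_def intro!: sum.cong simp del: sum.delta sum.delta')
  then show ?thesis by simp
qed

lemma inner_diag_mat: "(diag_mat m *v x) \<bullet> y = (\<Sum>k\<in>UNIV. m $ k * x $ k * y $ k)"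
  by (simp add: inner_vec_def diag_mat_mult_nth)

lemma energy_eq: "energy A m p x = (A *v x) \<bullet> x / 2 - moment m (p + 1) x / (p + 1)"
  by (simp add: energy_def inner_diag_mat moment_def vec_powr_def)

lemma symmetric_inner_commute:
  fixes A :: "real ^ 'n ^ 'n"
  assumes "transpose A = A"
  shows "(A *v x) \<bullet> y = (A *v y) \<bullet> x"
  using assms by (metis dot_lmul_matrix inner_commute transpose_matrix_vector)

lemma powr_convex_tangent:
  fixes x y q :: real
  assumes "x > 0" "y > 0" "q > 0"
  shows "y powr (q + 1) - x powr (q + 1) \<ge> (q + 1) * x powr q * (y - x)"
proof -
  have "convex_on {0<..} (\<lambda>x. x powr (q + 1))"
    using powr_convex[of "q+1"] assms by (auto intro: convex_on_subset)
  moreover have "((\<lambda>x. x powr (q + 1)) has_real_derivative (q + 1) * x powr q) (at x within {0<..})"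
    using assms by (auto intro!: derivative_eq_intros)
  ultimately show ?thesis
    using convex_on_imp_above_tangent[of "{0<..}" "\<lambda>x. x powr (q + 1)" x y "(q + 1) * x powr q"]
      assms by (simp add: interior_open)
qed

text \<open>
  The two estimates below hold for every positive step size \<open>\<tau>\<close>; the coupling of \<open>\<tau>\<close> to the mass
  matters only when they are iterated.
\<close>

context
  fixes A :: "real ^ 'n ^ 'n" and m x x' :: "real ^ 'n" and p \<tau> :: real
  assumes p: "p > 1" and m: "\<And>k. m $ k > 0"
    and sym: "transpose A = A" and psd: "psd A" and \<tau>: "\<tau> > 0"
    and x: "\<And>k. x $ k > 0" and x': "\<And>k. x' $ k > 0"
    and step: "diag_mat m *v x' =
      diag_mat m *v x + \<tau> *\<^sub>R (- (A *v x') + diag_mat m *v vec_powr x p)"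
begin

abbreviation (input) increment2 :: real where
  "increment2 \<equiv> \<Sum>k\<in>UNIV. m $ k * (x' $ k - x $ k)\<^sup>2"

lemma step_tested:
  "(\<Sum>k\<in>UNIV. m $ k * (x' $ k - x $ k) * y $ k) =
     \<tau> * ((\<Sum>k\<in>UNIV. m $ k * x $ k powr p * y $ k) - (A *v x') \<bullet> y)"
proof -
  have "(diag_mat m *v x') \<bullet> y = (diag_mat m *v x +
      \<tau> *\<^sub>R (- (A *v x') + diag_mat m *v vec_powr x p)) \<bullet> y"
    using step by simp
  then show ?thesis
    by (simp add: inner_add_left inner_diag_mat vec_powr_def algebra_simps sum_subtractf)
qed

lemma quadratic_form_diff:
  "(A *v (x' - x)) \<bullet> (x' - x) = (A *v x') \<bullet> x' - 2 * ((A *v x') \<bullet> x) + (A *v x) \<bullet> x"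
  using symmetric_inner_commute[OF sym, of x x']
  by (simp add: matrix_vector_mult_diff_distrib inner_diff_left inner_diff_right)

lemma step_tested_increment:
  "increment2 = \<tau> * ((\<Sum>k\<in>UNIV. m $ k * x $ k powr p * (x' $ k - x $ k))
     - (A *v x') \<bullet> x' + (A *v x') \<bullet> x)"
  using step_tested[of "x' - x"]
  by (simp add: power2_eq_square mult.assoc inner_diff_right algebra_simps)

text \<open>
  Test the step with the increment \<open>d = x' - x\<close>. By symmetry \<open>\<langle>A x', d\<rangle>\<close> is the difference of the
  quadratic parts of the energy plus \<open>\<langle>A d, d\<rangle> / 2 \<ge> 0\<close>, and the tangent inequality for
  \<open>t powr (p + 1)\<close> at the old value compares \<open>\<langle>M x^p, d\<rangle>\<close> with the difference of the source parts.
\<close>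

lemma energy_decay: "increment2 / \<tau> \<le> energy A m p x - energy A m p x'"
proof -
  let ?P = "\<Sum>k\<in>UNIV. m $ k * x $ k powr p * (x' $ k - x $ k)"
  have "(p + 1) * ?P \<le> moment m (p + 1) x' - moment m (p + 1) x"
    unfolding moment_def sum_distrib_left sum_subtractf[symmetric]
  proof (rule sum_mono)
    fix k
    have "m $ k * ((p + 1) * x $ k powr p * (x' $ k - x $ k))
        \<le> m $ k * (x' $ k powr (p + 1) - x $ k powr (p + 1))"
      using powr_convex_tangent[OF x x', of p] p m[of k] by (intro mult_left_mono) (auto intro: less_imp_le)
    then show "(p + 1) * (m $ k * x $ k powr p * (x' $ k - x $ k))
        \<le> m $ k * x' $ k powr (p + 1) - m $ k * x $ k powr (p + 1)"
      by (simp add: algebra_simps)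
  qed
  then have "?P \<le> moment m (p + 1) x' / (p + 1) - moment m (p + 1) x / (p + 1)"
    using p by (simp add: pos_le_divide_eq mult.commute flip: diff_divide_distrib)
  moreover have "increment2 / \<tau> = ?P - (A *v x') \<bullet> x' + (A *v x') \<bullet> x"
    using step_tested_increment \<tau> by (simp add: field_simps)
  moreover have "0 \<le> (A *v x') \<bullet> x' - 2 * ((A *v x') \<bullet> x) + (A *v x) \<bullet> x"
    using psd quadratic_form_diff unfolding psd_def by metis
  ultimately show ?thesis
    unfolding energy_eq by linarith
qed

text \<open>
  The increment of the second moment is \<open>2 \<langle>M d, x\<rangle> + \<langle>M d, d\<rangle>\<close>. Testing the step with \<open>x\<close> leaves
  the mixed term \<open>\<langle>A x', x\<rangle>\<close>; the step tested with \<open>d\<close> and the expansion of \<open>\<langle>A d, d\<rangle>\<close> express it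
  through quantities at \<open>x\<close>, the nonnegative \<open>\<langle>A d, d\<rangle>\<close>, and \<open>\<langle>M x^p, d\<rangle>\<close>. The last is split by
  Young's inequality, with a weight \<open>s\<close> left free so that its two parts can be balanced according to
  what is available to absorb them.
\<close>

lemma second_moment_growth:
  assumes s: "s > 0"
  shows "moment m 2 x' - moment m 2 x \<ge>
     (3 - 1 / s) * increment2 - s * (\<tau>\<^sup>2 * moment m (2 * p) x)
     + \<tau> * (2 * (p - 1) / (p + 1) * moment m (p + 1) x - 4 * energy A m p x)"
proof -
  let ?P = "\<Sum>k\<in>UNIV. m $ k * x $ k powr p * (x' $ k - x $ k)"
  let ?L = "\<Sum>k\<in>UNIV. m $ k * (x' $ k - x $ k) * x $ k"
  let ?a0 = "(A *v x) \<bullet> x" and ?a1 = "(A *v x') \<bullet> x'" and ?b = "(A *v x') \<bullet> x"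
  let ?ad = "(A *v (x' - x)) \<bullet> (x' - x)"
  have "moment m 2 x' - moment m 2 x = 2 * ?L + increment2"
    unfolding moment_def sum_distrib_left sum_subtractf[symmetric] sum.distrib[symmetric]
    using x x' by (intro sum.cong) (auto simp: less_imp_le power2_eq_square algebra_simps)
  moreover have "?L = \<tau> * (moment m (p + 1) x - ?b)"
    unfolding step_tested moment_def using x
    by (auto simp: powr_add mult.assoc less_imp_le)
  moreover have "increment2 = \<tau> * (?P - ?a1 + ?b)"
    by (rule step_tested_increment)
  moreover have "?ad = ?a1 - 2 * ?b + ?a0"
    by (rule quadratic_form_diff)
  ultimately have "moment m 2 x' - moment m 2 x = 3 * increment2 + 2 * \<tau> * ?ad
      + \<tau> * (2 * moment m (p + 1) x - 2 * ?a0) - 2 * \<tau> * ?P"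
    by (simp add: algebra_simps)
  moreover have "2 * moment m (p + 1) x - 2 * ?a0
      = 2 * (p - 1) / (p + 1) * moment m (p + 1) x - 4 * energy A m p x"
  proof -
    have "2 * (p - 1) / (p + 1) = 2 - 4 / (p + 1)"
      using p by (simp add: field_simps)
    then show ?thesis
      unfolding energy_eq by (simp add: left_diff_distrib)
  qed
  moreover have "0 \<le> 2 * \<tau> * ?ad"
    using psd \<tau> unfolding psd_def by auto
  moreover have "2 * \<tau> * ?P \<le> 1 / s * increment2 + s * (\<tau>\<^sup>2 * moment m (2 * p) x)"
    unfolding moment_def sum_distrib_left sum.distrib[symmetric]
  proof (rule sum_mono)
    fix k
    let ?d = "x' $ k - x $ k" and ?u = "x $ k powr p"
    \<comment> \<open>Young's inequality, summand by summand, from a completed square.\<close>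
    have "0 \<le> m $ k / s * (?d - s * \<tau> * ?u)\<^sup>2"
      using m[of k] s by simp
    moreover have "m $ k / s * (?d - s * \<tau> * ?u)\<^sup>2 = 1 / s * (m $ k * ?d\<^sup>2) + s * (\<tau>\<^sup>2 * (m $ k * ?u\<^sup>2)) - 2 * \<tau> * (m $ k * ?u * ?d)"
      using s by (simp add: field_simps power2_eq_square)
    moreover have "x $ k powr (2 * p) = ?u\<^sup>2"
      by (simp add: power2_eq_square flip: powr_add)
    ultimately show "2 * \<tau> * (m $ k * ?u * ?d)
        \<le> 1 / s * (m $ k * ?d\<^sup>2) + s * (\<tau>\<^sup>2 * (m $ k * x $ k powr (2 * p)))"
      by simp
  qed
  ultimately show ?thesis
    by (simp add: left_diff_distrib)
qed

end

section \<open>Growth of real sequences\<close>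

lemma filterlim_at_top_of_increments:
  fixes z :: "nat \<Rightarrow> real"
  assumes "\<delta> > 0" and "\<And>j. j \<ge> J \<Longrightarrow> z (Suc j) \<ge> z j + \<delta>"
  shows "filterlim z at_top sequentially"
proof -
  have lin: "z (J + n) \<ge> z J + \<delta> * real n" for n
  proof (induction n)
    case (Suc n)
    then show ?case using assms(2)[of "J + n"] by (simp add: algebra_simps)
  qed simp
  have "filterlim (\<lambda>n. z J + \<delta> * real n) at_top sequentially"
    using assms(1)
    by (intro filterlim_tendsto_add_at_top[OF tendsto_const]
        filterlim_tendsto_pos_mult_at_top[OF tendsto_const] filterlim_real_sequentially)
  then have "filterlim (\<lambda>n. z (n + J)) at_top sequentially"
    by (rule filterlim_at_top_mono) (use lin in \<open>simp add: add.commute\<close>)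
  then show ?thesis
    unfolding filterlim_at_top by (subst (asm) eventually_sequentially_seg)
qed

text \<open>
  This is the discrete form of \<open>y' \<ge> a sqrt y\<close>, which makes \<open>sqrt y\<close> grow at rate \<open>a / 2\<close>. Completing
  the square costs \<open>a\<^sup>2 / 16\<close>, which the starting condition covers once the rate is lowered
  to \<open>a / 4\<close>.
\<close>

lemma sqrt_linear_growth:
  fixes y :: "nat \<Rightarrow> real"
  assumes a: "a > 0"
    and start: "\<And>j. j \<ge> J \<Longrightarrow> sqrt (y j) \<ge> a"
    and step: "\<And>j. j \<ge> J \<Longrightarrow> y (Suc j) \<ge> y j + a * sqrt (y j)"
  shows "sqrt (y (J + n)) \<ge> a / 4 * real n"
proof (induction n)
  case 0
  show ?case using order_trans[OF less_imp_le[OF a] start[of J]] by simp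
next
  case (Suc n)
  let ?r = "sqrt (y (J + n))"
  have r: "?r \<ge> a" using start by simp
  have "?r > 0" using a r by linarith
  then have "y (J + n) = ?r\<^sup>2" by simp
  have "a * a \<le> a * ?r" using a r by simp
  moreover have "a * a > 0" using a by simp
  ultimately have "(?r + a / 4)\<^sup>2 \<le> ?r\<^sup>2 + a * ?r"
    by (simp add: power2_eq_square algebra_simps)
  also have "\<dots> \<le> y (J + Suc n)"
    using step[of "J + n"] \<open>y (J + n) = ?r\<^sup>2\<close> by simp
  finally have "?r + a / 4 \<le> sqrt (y (J + Suc n))"
    by (rule real_le_rsqrt)
  then show ?case
    using Suc by (simp add: algebra_simps)
qed

section \<open>Blow-up\<close>

theorem theorem3p1:
  fixes A :: "real ^ 'n ^ 'n" and m :: "real ^ 'n" and p lam :: real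
    and U :: "nat \<Rightarrow> real ^ 'n"
  assumes "p > 1"
    and "\<And>k. m $ k > 0"
    and "transpose A = A"
    and "psd A"
    and "\<And>i k. i \<noteq> k \<Longrightarrow> A $ i $ k \<le> 0"
    and "\<And>i. A $ i $ i > 0"
    and "\<And>i. (\<Sum>k\<in>UNIV. A $ i $ k) \<ge> 0"
    and "lam > 0"
    and "implicit_scheme A m p lam U"
    and "\<And>j i. U j $ i > 0"
    and "\<exists>j0. energy A m p (U j0) < 0"
  shows "blows_up m p lam U"
proof -
  note p = assms(1) and m = assms(2) and lam = assms(8) and pos = assms(10)
  define \<mu> where "\<mu> = Min (range (($) m))"
  have \<mu>: "\<mu> > 0" "\<And>k. \<mu> \<le> m $ k"
    unfolding \<mu>_def using m by auto
  define W where "W = (\<Sum>k\<in>UNIV. m $ k)"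
  have W: "W > 0"
    unfolding W_def using m by (intro sum_pos) auto
  define w where "w j = mass m (U j)" for j
  have w: "w j > 0" for j
    unfolding w_def mass_def using m pos by (intro sum_pos) auto
  define \<tau> where "\<tau> j = lam / w j powr p" for j
  have \<tau>: "\<tau> j > 0" for j
    unfolding \<tau>_def using lam w[of j] by simp
  have \<tau>_step: "time_step m p lam U = \<tau>"
    by (simp add: fun_eq_iff time_step_def \<tau>_def w_def)
  define y where "y j = moment m 2 (U j)" for j
  define S where "S j = moment m (p + 1) (U j)" for j
  define \<Phi> where "\<Phi> j = energy A m p (U j)" for j
  define D where "D j = (\<Sum>k\<in>UNIV. m $ k * (U (Suc j) $ k - U j $ k)\<^sup>2)" for j
  define \<kappa> where "\<kappa> = 2 * (p - 1) / (p + 1)"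
  have \<kappa>: "\<kappa> > 0" unfolding \<kappa>_def using p by simp
  have step: "diag_mat m *v U (Suc j) = diag_mat m *v U j +
      \<tau> j *\<^sub>R (- (A *v U (Suc j)) + diag_mat m *v vec_powr (U j) p)" for j
    using assms(9) unfolding implicit_scheme_def \<tau>_step by blast
  have D: "D j \<ge> 0" for j
    unfolding D_def using m by (intro sum_nonneg) (auto intro!: mult_nonneg_nonneg simp: less_imp_le)

  have moment_le: "moment m q (U j) \<le> W * (w j / \<mu>) powr q"
    and moment_ge: "\<mu> * (w j / W) powr q \<le> moment m q (U j)" if "q \<ge> 0" for q j
    unfolding W_def w_def
    using moment_le_mass_powr[OF \<mu> pos that] mass_powr_le_moment[OF \<mu> pos that] by auto

  have decay: "D j / \<tau> j \<le> \<Phi> j - \<Phi> (Suc j)" for j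
    unfolding D_def \<Phi>_def by (rule energy_decay[OF p m assms(3,4) \<tau> pos pos step])

  \<comment> \<open>The powers of the mass cancel in \<open>\<tau>\<^sup>2\<close> times the moment of order \<open>2 p\<close>.\<close>
  define K where "K = lam\<^sup>2 * W / \<mu> powr (2 * p)"
  have K: "K > 0" unfolding K_def using lam W \<mu> by simp
  have Q: "(\<tau> j)\<^sup>2 * moment m (2 * p) (U j) \<le> K" for j
  proof -
    have "(\<tau> j)\<^sup>2 * moment m (2 * p) (U j) \<le> (\<tau> j)\<^sup>2 * (W * (w j / \<mu>) powr (2 * p))"
      using p by (intro mult_left_mono moment_le) auto
    also have "\<dots> = K"
      using w[of j] \<mu>(1)
      by (simp add: K_def \<tau>_def powr_divide power_divide powr_power mult.commute[of 2 p])
    finally show ?thesis .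
  qed
  have growth: "y (Suc j) - y j \<ge> (3 - 1 / s) * D j - s * K + \<tau> j * (\<kappa> * S j - 4 * \<Phi> j)"
    if "s > 0" for s j
    using second_moment_growth[OF p m assms(3,4) \<tau> pos pos step that, of j]
      mult_left_mono[OF Q[of j], of s] that
    unfolding D_def y_def S_def \<Phi>_def \<kappa>_def by linarith

  \<comment> \<open>In \<open>\<tau>\<close> times the moment of order \<open>p + 1\<close> exactly one power of the mass survives.\<close>
  define C where "C = \<kappa> * (lam * \<mu> / W powr (p + 1))"
  have C: "C > 0" unfolding C_def using \<kappa> lam \<mu> W by simp
  have source: "\<tau> j * (\<kappa> * S j) \<ge> C * w j" for j
  proof -
    have "C * w j = \<tau> j * (\<kappa> * (\<mu> * (w j / W) powr (p + 1)))"
      using w[of j] W by (simp add: C_def \<tau>_def powr_divide powr_add field_simps)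
    also have "\<dots> \<le> \<tau> j * (\<kappa> * S j)"
      unfolding S_def using p \<tau>[of j] \<kappa> by (intro mult_left_mono moment_ge) auto
    finally show ?thesis .
  qed

  obtain j0 where j0: "\<Phi> j0 < 0"
    using assms(11) unfolding \<Phi>_def by blast
  define c where "c = - \<Phi> j0"
  have c: "c > 0" using j0 by (simp add: c_def)
  have "\<Phi> (Suc j) \<le> \<Phi> j" for j
    using decay[of j] divide_nonneg_pos[OF D \<tau>, of j j] by linarith
  then have \<Phi>c: "\<Phi> j \<le> - c" if "j \<ge> j0" for j
    using that decseqD[of \<Phi> j0 j] by (simp add: decseq_Suc_iff c_def)

  have w_top: "filterlim w at_top sequentially"
  proof -
    \<comment> \<open>For the weight \<open>s = \<tau> / G\<close> the error \<open>s K\<close> is \<open>2 c \<tau>\<close>, half of the gain \<open>4 c \<tau>\<close> from the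
      negative energy, and the error \<open>D / s\<close> is at most \<open>G\<close> times the energy loss.\<close>
    define G where "G = K / (2 * c)"
    have G: "G > 0" using K c by (simp add: G_def)
    define z where "z j = y j - G * \<Phi> j" for j
    define \<delta> where "\<delta> = min (2 * c * lam) C"
    have "z (Suc j) \<ge> z j + \<delta>" if j: "j \<ge> j0" for j
    proof -
      have "1 / (\<tau> j / G) * D j = G * (D j / \<tau> j)" "\<tau> j / G * K = 2 * c * \<tau> j"
        using \<tau>[of j] G K c by (simp_all add: G_def)
      moreover have "G * (D j / \<tau> j) \<le> G * (\<Phi> j - \<Phi> (Suc j))"
        using decay[of j] G by (intro mult_left_mono) auto
      moreover have "\<tau> j * (4 * c) \<le> \<tau> j * (- 4 * \<Phi> j)"
        using \<Phi>c[OF j] \<tau>[of j] by (intro mult_left_mono) auto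
      ultimately have "z (Suc j) - z j \<ge> 2 * c * \<tau> j + C * w j"
        using growth[of "\<tau> j / G" j] \<tau>[of j] G source[of j] D[of j]
        by (simp add: z_def algebra_simps)
      moreover have "2 * c * \<tau> j + C * w j \<ge> \<delta>"
      proof (cases "w j \<le> 1")
        case True
        then have "w j powr p \<le> 1" using w[of j] p by (simp add: powr_le1)
        then have "lam \<le> \<tau> j" using w[of j] lam by (simp add: \<tau>_def field_simps)
        then have "2 * c * lam \<le> 2 * c * \<tau> j" using c by simp
        moreover have "0 \<le> C * w j" using C w[of j] by simp
        ultimately show ?thesis by (simp add: \<delta>_def)
      next
        case False
        then have "C * 1 \<le> C * w j" using C by (intro mult_left_mono) auto
        moreover have "0 \<le> 2 * c * \<tau> j" using c \<tau>[of j] by simp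
        ultimately show ?thesis unfolding \<delta>_def by linarith
      qed
      ultimately show ?thesis by linarith
    qed
    moreover have "\<delta> > 0" unfolding \<delta>_def using c lam C by simp
    ultimately have z_top: "filterlim z at_top sequentially"
      by (rule filterlim_at_top_of_increments[rotated])
    \<comment> \<open>A monotone bound in terms of the mass transfers divergence from \<open>z\<close> to \<open>w\<close>.\<close>
    define F where "F v = W * (v / \<mu>) powr 2 + G / (p + 1) * (W * (v / \<mu>) powr (p + 1))" for v
    have zF: "z j \<le> F (w j)" for j
    proof -
      have "- \<Phi> j \<le> S j / (p + 1)"
        using assms(4) unfolding \<Phi>_def S_def energy_eq psd_def by simp
      also have "\<dots> \<le> W * (w j / \<mu>) powr (p + 1) / (p + 1)"
        unfolding S_def using p by (intro divide_right_mono moment_le) auto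
      finally have "G * (- \<Phi> j) \<le> G * (W * (w j / \<mu>) powr (p + 1) / (p + 1))"
        using G by (intro mult_left_mono) auto
      moreover have "y j \<le> W * (w j / \<mu>) powr 2"
        unfolding y_def by (intro moment_le) auto
      ultimately show ?thesis by (simp add: z_def F_def)
    qed
    have F_mono: "F u \<le> F v" if "0 < u" "u \<le> v" for u v
      unfolding F_def using that W G p \<mu>(1)
      by (intro add_mono mult_left_mono powr_mono2 divide_right_mono) auto
    show ?thesis
      unfolding filterlim_at_top
    proof
      fix B :: real
      have "eventually (\<lambda>j. z j > F B) sequentially"
        using z_top by (simp add: filterlim_at_top_dense)
      then show "eventually (\<lambda>j. B \<le> w j) sequentially"
      proof eventually_elim
        case (elim j)
        then have "\<not> w j \<le> B"
          using F_mono[OF w, of j B] zF[of j] by fastforce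
        then show ?case by simp
      qed
    qed
  qed

  \<comment> \<open>Half of the gain \<open>C w\<close> will absorb \<open>K\<close>; the other half dominates \<open>a sqrt y\<close>.\<close>
  define a where "a = C / 2 * (\<mu> / sqrt W)"
  have a: "a > 0" using C \<mu> W by (simp add: a_def)
  have w_ge: "\<mu> / sqrt W * sqrt (y j) \<le> w j" for j
  proof -
    have "y j \<le> W * (w j / \<mu>) powr 2" unfolding y_def by (intro moment_le) auto
    then have "sqrt (y j) \<le> sqrt (W * (w j / \<mu>)\<^sup>2)"
      using w[of j] \<mu>(1) by simp
    also have "\<dots> = sqrt W * (w j / \<mu>)"
      using w[of j] \<mu>(1) by (simp add: real_sqrt_mult)
    finally show ?thesis using W \<mu>(1) by (simp add: field_simps)
  qed
  have w_le: "w j \<le> W / sqrt \<mu> * sqrt (y j)" for j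
  proof -
    have "\<mu> * (w j / W) powr 2 \<le> y j" unfolding y_def by (intro moment_ge) auto
    then have "sqrt (\<mu> * (w j / W)\<^sup>2) \<le> sqrt (y j)"
      using w[of j] W by simp
    moreover have "sqrt (\<mu> * (w j / W)\<^sup>2) = sqrt \<mu> * (w j / W)"
      using w[of j] W by (simp add: real_sqrt_mult)
    ultimately have "sqrt \<mu> * (w j / W) \<le> sqrt (y j)" by linarith
    then show ?thesis using W \<mu>(1) by (simp add: field_simps)
  qed
  have "eventually (\<lambda>j. w j \<ge> max (2 * K / C) (W / sqrt \<mu> * a) \<and> j \<ge> j0) sequentially"
    using w_top by (auto simp: filterlim_at_top eventually_ge_at_top intro!: eventually_conj)
  then obtain J where J: "\<And>j. j \<ge> J \<Longrightarrow> w j \<ge> 2 * K / C" "\<And>j. j \<ge> J \<Longrightarrow> w j \<ge> W / sqrt \<mu> * a"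
      "\<And>j. j \<ge> J \<Longrightarrow> j \<ge> j0"
    unfolding eventually_sequentially by auto
  have y_lin: "sqrt (y (J + n)) \<ge> a / 4 * real n" for n
  proof (rule sqrt_linear_growth[OF a])
    fix j assume j: "j \<ge> J"
    have "W / sqrt \<mu> * a \<le> W / sqrt \<mu> * sqrt (y j)"
      using J(2)[OF j] w_le[of j] by linarith
    then show "sqrt (y j) \<ge> a"
      using W \<mu>(1) by (simp add: field_simps)
    have "0 \<le> \<tau> j * (- 4 * \<Phi> j)"
      using \<Phi>c[OF J(3)[OF j]] c \<tau>[of j] by (simp add: mult_le_0_iff)
    then have "y (Suc j) - y j \<ge> C * w j - K"
      using growth[of 1 j] source[of j] D[of j] by (simp add: algebra_simps)
    moreover have "K \<le> C / 2 * w j"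
      using J(1)[OF j] C by (simp add: field_simps)
    moreover have "a * sqrt (y j) \<le> C / 2 * w j"
      using mult_left_mono[OF w_ge[of j], of "C / 2"] C by (simp add: a_def mult.assoc)
    ultimately show "y (Suc j) \<ge> y j + a * sqrt (y j)" by linarith
  qed
  define e where "e = \<mu> / sqrt W * (a / 4)"
  have e: "e > 0" using \<mu> W a by (simp add: e_def)
  have w_lin: "w (n + J) \<ge> e * real n" for n
  proof -
    have "e * real n = \<mu> / sqrt W * (a / 4 * real n)" by (simp add: e_def)
    also have "\<dots> \<le> \<mu> / sqrt W * sqrt (y (J + n))"
      using y_lin[of n] \<mu> W by (intro mult_left_mono) auto
    also have "\<dots> \<le> w (n + J)" using w_ge[of "J + n"] by (simp add: add.commute)
    finally show ?thesis .
  qed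
  have "summable (\<lambda>n. \<tau> (n + J))"
  proof (rule summable_comparison_test')
    show "summable (\<lambda>n. lam / e powr p * real n powr (- p))"
      using p by (intro summable_mult) (simp add: summable_real_powr_iff)
    fix n :: nat assume n: "n \<ge> 1"
    have "(e * real n) powr p \<le> w (n + J) powr p"
      using w_lin[of n] e n p by (intro powr_mono2) auto
    then have "\<tau> (n + J) \<le> lam / (e * real n) powr p"
      unfolding \<tau>_def using lam e n w by (intro divide_left_mono mult_pos_pos) auto
    also have "\<dots> = lam / e powr p * real n powr (- p)"
      using e by (simp add: powr_mult powr_minus field_simps)
    finally show "norm (\<tau> (n + J)) \<le> lam / e powr p * real n powr (- p)"
      using \<tau>[of "n + J"] by simp
  qed
  then have summ: "summable \<tau>"
    using summable_iff_shift by blast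

  have "w j / W \<le> infnorm (U j)" for j
  proof -
    have "w j \<le> (\<Sum>k\<in>UNIV. m $ k * infnorm (U j))"
      unfolding w_def mass_def
    proof (intro sum_mono mult_left_mono)
      show "U j $ k \<le> infnorm (U j)" for k
        using component_le_infnorm_cart[of "U j" k] by linarith
    qed (use m in \<open>auto intro: less_imp_le\<close>)
    then show ?thesis
      using W by (simp add: W_def field_simps flip: sum_distrib_right)
  qed
  moreover have "filterlim (\<lambda>j. w j / W) at_top sequentially"
    using filterlim_tendsto_pos_mult_at_top[OF tendsto_const[of "1 / W"] _ w_top] W by simp
  ultimately have "filterlim (\<lambda>j. infnorm (U j)) at_top sequentially"
    by (auto elim!: filterlim_at_top_mono)
  then show ?thesis
    unfolding blows_up_def \<tau>_step using summ by blast
qed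

end
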